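(* Let $n\ge 2$ be an integer. For every integer $m\in\{1,\dots,n-1\}$ there is a graph $G$ such that $\nu(H)=n$ and $\gamma(H)=m$ for every $H\in\Gamma_0(G)$.
   Context: A hypergraph $H$ has a finite non-empty vertex set and a collection of non-empty subsets (hyperedges); rank is the maximum hyperedge size. Two vertices are adjacent if some hyperedge contains both. $\nu(H)$ is the maximum number of pairwise disjoint hyperedges; $\gamma(H)$ is the minimum size of a set $D$ of vertices such that every vertex not in $D$ is adjacent to a vertex of $D$. Dilation of a simple graph $G$: for $k\ge 3$, assign to each vertex $v$ a positive integer $s_v$ with $s_u+s_v\le k$ for every edge $uv$; for each vertex $v$ let $\mathbf v$ be an $s_v$-set containing $v$, and for each edge $e=uv$ let $\mathbf e$ be a set of size at most $k-s_u-s_v$, all these sets pairwise disjoint. A dilation of $G$ is a hypergraph of rank $k$ with vertex set $\bigcup_v\mathbf v\cup\bigcup_e\mathbf e$ and hyperedges $\mathbf u\cup\mathbf v\cup\mathbf e$ for $e=uv\in E(G)$. $\Gamma_0(G)$ is the set of dilations of $G$ with $\mathbf e=\emptyset$ for every edge $e$. *)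

theory Defs
  imports Main "HOL-Library.Disjoint_Sets"
begin

record 'a hypergraph =
  verts :: "'a set"
  hyperedges :: "'a set set"

definition hypergraph :: "'a hypergraph \<Rightarrow> bool" where
  "hypergraph H \<longleftrightarrow> finite (verts H) \<and> verts H \<noteq> {} \<and>
     (\<forall>e\<in>hyperedges H. e \<noteq> {} \<and> e \<subseteq> verts H)"

definition simple_graph :: "'a hypergraph \<Rightarrow> bool" where
  "simple_graph G \<longleftrightarrow> hypergraph G \<and> (\<forall>e\<in>hyperedges G. card e = 2)"

text \<open>The rank of a hypergraph without hyperedges is taken to be 0.\<close>

definition rank :: "'a hypergraph \<Rightarrow> nat" where
  "rank H = (if hyperedges H = {} then 0 else Max (card ` hyperedges H))"

definition adjacent :: "'a hypergraph \<Rightarrow> 'a \<Rightarrow> 'a \<Rightarrow> bool" where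
  "adjacent H x y \<longleftrightarrow> x \<noteq> y \<and> (\<exists>e\<in>hyperedges H. x \<in> e \<and> y \<in> e)"

definition matching :: "'a hypergraph \<Rightarrow> 'a set set \<Rightarrow> bool" where
  "matching H M \<longleftrightarrow> M \<subseteq> hyperedges H \<and> disjoint M"

definition matching_number :: "'a hypergraph \<Rightarrow> nat" where
  "matching_number H = Max {card M | M. matching H M}"

definition dominating_set :: "'a hypergraph \<Rightarrow> 'a set \<Rightarrow> bool" where
  "dominating_set H D \<longleftrightarrow> D \<subseteq> verts H \<and> (\<forall>x\<in>verts H - D. \<exists>y\<in>D. adjacent H x y)"

definition domination_number :: "'a hypergraph \<Rightarrow> nat" where
  "domination_number H = Min {card D | D. dominating_set H D}"

text \<open>
  In \<open>dilation_with k G s B C H\<close>, the function \<open>s\<close> gives the sizes \<open>s\<^sub>v\<close>, while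
  \<open>B v\<close> and \<open>C e\<close> are the sets that replace a vertex \<open>v\<close> and are added for an edge \<open>e\<close>.
  The rank of \<open>H\<close> is exactly \<open>k\<close>. The vertices of \<open>H\<close> come from the same type as those
  of \<open>G\<close>, since \<open>v \<in> B v\<close>.
\<close>

definition dilation_with ::
  "nat \<Rightarrow> 'a hypergraph \<Rightarrow> ('a \<Rightarrow> nat) \<Rightarrow> ('a \<Rightarrow> 'a set) \<Rightarrow> ('a set \<Rightarrow> 'a set) \<Rightarrow>
    'a hypergraph \<Rightarrow> bool" where
  "dilation_with k G s B C H \<longleftrightarrow>
     (\<forall>v\<in>verts G. 0 < s v) \<and>
     (\<forall>u v. {u, v} \<in> hyperedges G \<longrightarrow> s u + s v \<le> k) \<and>
     (\<forall>v\<in>verts G. v \<in> B v \<and> finite (B v) \<and> card (B v) = s v) \<and>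
     (\<forall>u v. {u, v} \<in> hyperedges G \<longrightarrow>
        finite (C {u, v}) \<and> card (C {u, v}) \<le> k - (s u + s v)) \<and>
     disjoint_family_on B (verts G) \<and>
     disjoint_family_on C (hyperedges G) \<and>
     (\<forall>v\<in>verts G. \<forall>e\<in>hyperedges G. B v \<inter> C e = {}) \<and>
     verts H = (\<Union>v\<in>verts G. B v) \<union> (\<Union>e\<in>hyperedges G. C e) \<and>
     hyperedges H = {B u \<union> B v \<union> C {u, v} | u v. {u, v} \<in> hyperedges G} \<and>
     rank H = k"

definition Gamma0 :: "'a hypergraph \<Rightarrow> 'a hypergraph set" where
  "Gamma0 G = {H. \<exists>k\<ge>3. \<exists>s B C. dilation_with k G s B C H \<and>
                 (\<forall>e\<in>hyperedges G. C e = {})}"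

end

(* A dilation with all edge sets empty just blows up every vertex v of G to a block B v, so it
   preserves the matching number, and, if G has no isolated vertex, also the domination number.
   It thus suffices to find G with matching number n and domination number m. The disjoint union
   of m - 1 copies of K_2 and one K_{2(n-m+1)} has a perfect matching with n edges, and a set
   dominates it iff it meets each of its m components. *)

theory Submission
  imports Defs
begin

section \<open>Blow-ups\<close>

lemma simple_graph_edgeE:
  assumes "simple_graph G" "e \<in> hyperedges G"
  obtains u v where "e = {u, v}" "u \<noteq> v" "u \<in> verts G" "v \<in> verts G"
  using assms unfolding simple_graph_def hypergraph_def by (metis card_2_iff insert_subset)

text \<open>The form in which \<open>Gamma0\<close> is used below: since the edge sets are empty,
  the hyperedges are the image of the edges of \<open>G\<close> under the single map that takes
  unions of blocks.\<close>

lemma Gamma0E: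
  assumes G: "simple_graph G" and "H \<in> Gamma0 G"
  obtains B where "\<And>v. v \<in> verts G \<Longrightarrow> v \<in> B v" "\<And>v. v \<in> verts G \<Longrightarrow> finite (B v)"
    "disjoint_family_on B (verts G)"
    "verts H = (\<Union>v\<in>verts G. B v)" "hyperedges H = (\<lambda>e. \<Union>v\<in>e. B v) ` hyperedges G"
proof -
  obtain k s B C where d: "dilation_with k G s B C H" and C: "\<forall>e\<in>hyperedges G. C e = {}"
    using assms(2) unfolding Gamma0_def by blast
  have "hyperedges H = {B u \<union> B v \<union> C {u, v} | u v. {u, v} \<in> hyperedges G}"
    using d unfolding dilation_with_def by blast
  also have "\<dots> = {B u \<union> B v | u v. {u, v} \<in> hyperedges G}"
    using C by fastforce
  also have "\<dots> = (\<lambda>e. \<Union>v\<in>e. B v) ` hyperedges G"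
  proof (intro equalityI subsetI)
    fix x assume "x \<in> {B u \<union> B v | u v. {u, v} \<in> hyperedges G}"
    then obtain u v where "{u, v} \<in> hyperedges G" "x = (\<Union>v\<in>{u, v}. B v)" by auto
    then show "x \<in> (\<lambda>e. \<Union>v\<in>e. B v) ` hyperedges G" by (rule rev_image_eqI)
  next
    fix x assume "x \<in> (\<lambda>e. \<Union>v\<in>e. B v) ` hyperedges G"
    then obtain e where e: "e \<in> hyperedges G" "x = (\<Union>v\<in>e. B v)" by blast
    then obtain u v where "e = {u, v}" using simple_graph_edgeE[OF G] by metis
    then show "x \<in> {B u \<union> B v | u v. {u, v} \<in> hyperedges G}" using e by auto
  qed
  finally show thesis
    using that[of B] d C unfolding dilation_with_def by auto
qed

text \<open>Blocks are non-empty and pairwise disjoint, so replacing an edge by the union of its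
  blocks preserves and reflects disjointness and is injective. Matchings of \<open>G\<close> and
  \<open>H\<close> thus correspond with equal sizes.\<close>

lemma matching_number_Gamma0:
  assumes G: "simple_graph G" and H: "H \<in> Gamma0 G"
  shows "matching_number H = matching_number G"
proof -
  obtain B where B: "\<And>v. v \<in> verts G \<Longrightarrow> v \<in> B v" and disj: "disjoint_family_on B (verts G)"
    and E: "hyperedges H = (\<lambda>e. \<Union>v\<in>e. B v) ` hyperedges G"
    using Gamma0E[OF G H] by metis
  define \<phi> where "\<phi> = (\<lambda>e. \<Union>v\<in>e. B v)"
  have sub: "e \<subseteq> verts G" if "e \<in> hyperedges G" for e
    using G that unfolding simple_graph_def hypergraph_def by blast
  have B_eq: "u = v" if "u \<in> verts G" "v \<in> verts G" "x \<in> B u" "x \<in> B v" for u v x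
    using that disj unfolding disjoint_family_on_def by blast
  have \<phi>: "\<phi> e \<inter> \<phi> e' = {} \<longleftrightarrow> e \<inter> e' = {}" if "e \<subseteq> verts G" "e' \<subseteq> verts G" for e e'
  proof
    assume "\<phi> e \<inter> \<phi> e' = {}"
    then show "e \<inter> e' = {}" using that B unfolding \<phi>_def by fast
  next
    assume "e \<inter> e' = {}"
    then show "\<phi> e \<inter> \<phi> e' = {}" using that B_eq unfolding \<phi>_def by fast
  qed
  \<comment> \<open>The only vertex of \<open>G\<close> in \<open>B v\<close> is \<open>v\<close>
    itself, so intersecting with \<open>verts G\<close> is a left inverse of
    \<open>\<phi>\<close>.\<close>
  have "\<phi> e \<inter> verts G = e" if "e \<subseteq> verts G" for e
  proof (intro equalityI subsetI)
    fix x assume "x \<in> \<phi> e \<inter> verts G"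
    then obtain v where "v \<in> e" "x \<in> B v" "x \<in> verts G" unfolding \<phi>_def by blast
    then show "x \<in> e" using B_eq[of x v x] B[of x] that by blast
  qed (use that B in \<open>auto simp: \<phi>_def\<close>)
  then have inj: "inj_on \<phi> (hyperedges G)"
    using sub by (metis inj_onI)
  have match: "matching H (\<phi> ` M) \<longleftrightarrow> matching G M" if M: "M \<subseteq> hyperedges G" for M
  proof -
    \<comment> \<open>\<open>disjoint\<close> compares only distinct members, so besides
      \<open>\<phi>\<close> reflecting disjointness, injectivity is used to keep distinct edges
      distinct.\<close>
    have "disjoint (\<phi> ` M) \<longleftrightarrow> disjoint M"
      unfolding disjoint_def Ball_image_comp comp_def
    proof (intro ball_cong refl)
      fix e e' assume "e \<in> M" "e' \<in> M"
      then have "e \<in> hyperedges G" "e' \<in> hyperedges G" using M by auto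
      then show "(\<phi> e \<noteq> \<phi> e' \<longrightarrow> \<phi> e \<inter> \<phi> e' = {}) \<longleftrightarrow> (e \<noteq> e' \<longrightarrow> e \<inter> e' = {})"
        using \<phi> sub inj by (simp add: inj_on_eq_iff)
    qed
    then show ?thesis using M E unfolding matching_def \<phi>_def by blast
  qed
  have "{card M | M. matching H M} = {card M | M. matching G M}"
  proof (intro equalityI subsetI)
    fix x assume "x \<in> {card M | M. matching H M}"
    then obtain N where N: "matching H N" "x = card N" by blast
    then obtain M where M: "M \<subseteq> hyperedges G" "N = \<phi> ` M"
      using E unfolding matching_def \<phi>_def by (metis subset_image_iff)
    then have "card N = card M" using inj card_image inj_on_subset by metis
    then show "x \<in> {card M | M. matching G M}" using N M match by blast
  next
    fix x assume "x \<in> {card M | M. matching G M}"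
    then obtain M where M: "matching G M" "x = card M" by blast
    then have s: "M \<subseteq> hyperedges G" unfolding matching_def by blast
    then have "card (\<phi> ` M) = card M" using inj card_image inj_on_subset by metis
    with M s match show "x \<in> {card M | M. matching H M}" by (metis (mono_tags) CollectI)
  qed
  then show ?thesis unfolding matching_number_def by simp
qed

section \<open>Domination numbers of blow-ups\<close>

lemma domination_number_eqI:
  assumes "finite (verts H)" "dominating_set H D" "card D = m"
    and "\<And>D'. dominating_set H D' \<Longrightarrow> m \<le> card D'"
  shows "domination_number H = m"
  unfolding domination_number_def
proof (rule Min_eqI)
  show "finite {card D | D. dominating_set H D}"
    by (rule finite_subset[of _ "card ` Pow (verts H)"])
      (use assms(1) in \<open>auto simp: dominating_set_def\<close>)
qed (use assms in auto)

lemma ex_minimum_dominating_set: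
  assumes "finite (verts G)"
  obtains D where "dominating_set G D" "card D = domination_number G"
    "\<And>D'. dominating_set G D' \<Longrightarrow> domination_number G \<le> card D'"
proof -
  let ?S = "{card D | D. dominating_set G D}"
  have fin: "finite ?S"
    by (rule finite_subset[of _ "card ` Pow (verts G)"])
      (use assms in \<open>auto simp: dominating_set_def\<close>)
  have "dominating_set G (verts G)" unfolding dominating_set_def by simp
  then have "?S \<noteq> {}" by blast
  with fin have "Min ?S \<in> ?S" by (rule Min_in)
  moreover have "Min ?S \<le> card D" if "dominating_set G D" for D
    using fin that by (intro Min_le) auto
  ultimately show thesis
    using that unfolding domination_number_def by auto
qed

text \<open>A minimum dominating set of \<open>G\<close> also dominates \<open>H\<close>, and
  sending each point of \<open>H\<close> to the vertex owning its block turns dominating sets of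
  \<open>H\<close> into ones of \<open>G\<close> that are no larger. An isolated vertex would become
  a block of pairwise non-adjacent points, which could raise the number.\<close>

lemma domination_number_Gamma0:
  assumes G: "simple_graph G" and H: "H \<in> Gamma0 G"
    and no_isolated: "\<And>v. v \<in> verts G \<Longrightarrow> \<exists>e\<in>hyperedges G. v \<in> e"
  shows "domination_number H = domination_number G"
proof -
  obtain B where B: "\<And>v. v \<in> verts G \<Longrightarrow> v \<in> B v" and finB: "\<And>v. v \<in> verts G \<Longrightarrow> finite (B v)"
    and disj: "disjoint_family_on B (verts G)" and V: "verts H = (\<Union>v\<in>verts G. B v)"
    and E: "hyperedges H = (\<lambda>e. \<Union>v\<in>e. B v) ` hyperedges G"
    using Gamma0E[OF G H] by metis
  have finG: "finite (verts G)" and sub: "\<And>e. e \<in> hyperedges G \<Longrightarrow> e \<subseteq> verts G"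
    using G unfolding simple_graph_def hypergraph_def by blast+
  have finH: "finite (verts H)" using finG finB V by simp
  obtain D where D: "dominating_set G D" "card D = domination_number G"
    and min: "\<And>D'. dominating_set G D' \<Longrightarrow> domination_number G \<le> card D'"
    using ex_minimum_dominating_set[OF finG] by metis
  show ?thesis
  proof (rule domination_number_eqI[OF finH])
    show "dominating_set H D" unfolding dominating_set_def
    proof (intro conjI ballI)
      have DG: "D \<subseteq> verts G" using D unfolding dominating_set_def by blast
      then show "D \<subseteq> verts H" using V B by blast
      fix x assume x: "x \<in> verts H - D"
      then obtain v where v: "v \<in> verts G" "x \<in> B v" using V by blast
      \<comment> \<open>If \<open>v\<close> is in \<open>D\<close>, then \<open>x\<close> is a
        further point of its block; take \<open>d = v\<close>, and any edge at \<open>v\<close>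
        makes \<open>x\<close> adjacent to it.\<close>
      have "\<exists>d\<in>D. \<exists>e\<in>hyperedges G. v \<in> e \<and> d \<in> e"
      proof (cases "v \<in> D")
        case True then show ?thesis using no_isolated v by blast
      next
        case False then show ?thesis using v D unfolding dominating_set_def adjacent_def by blast
      qed
      then obtain d e where d: "d \<in> D" "e \<in> hyperedges G" "v \<in> e" "d \<in> e" by blast
      let ?e = "\<Union>w\<in>e. B w"
      have "?e \<in> hyperedges H" unfolding E using d(2) by (rule imageI)
      moreover have "x \<in> ?e" using v(2) d(3) by blast
      moreover have "d \<in> ?e" using B DG d(1,4) by blast
      moreover have "x \<noteq> d" using x d(1) by blast
      ultimately show "\<exists>d\<in>D. adjacent H x d"
        using d(1) unfolding adjacent_def by metis
    qed
    show "card D = domination_number G" by fact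
    fix D' assume D': "dominating_set H D'"
    \<comment> \<open>The projection onto \<open>G\<close>; disjointness of the blocks makes the
      owner of a point unique.\<close>
    define c where "c x = (THE v. v \<in> verts G \<and> x \<in> B v)" for x
    have c: "c x = v" if "v \<in> verts G" "x \<in> B v" for x v
      unfolding c_def using that disj by (intro the_equality) (auto simp: disjoint_family_on_def)
    have "dominating_set G (c ` D')" unfolding dominating_set_def
    proof (intro conjI ballI)
      show "c ` D' \<subseteq> verts G"
        using D' c unfolding dominating_set_def V by fastforce
      fix v assume v: "v \<in> verts G - c ` D'"
      \<comment> \<open>\<open>c\<close> fixes the vertices of \<open>G\<close>, so a
        \<open>v\<close> outside the image of \<open>D'\<close> is not in \<open>D'\<close>
        itself.\<close>
      then have "v \<in> verts H - D'" using B V c by (metis DiffD1 DiffD2 DiffI UN_I image_eqI)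
      then obtain d where d: "d \<in> D'" "adjacent H v d" using D' unfolding dominating_set_def by blast
      then obtain e where e: "e \<in> hyperedges G" "v \<in> (\<Union>w\<in>e. B w)" "d \<in> (\<Union>w\<in>e. B w)"
        unfolding adjacent_def E by blast
      have c_edge: "c x \<in> e" if "x \<in> (\<Union>w\<in>e. B w)" for x
        using that c sub[OF e(1)] by (metis UN_E subsetD)
      have "v \<in> e" "c d \<in> e" using c_edge[OF e(2)] c_edge[OF e(3)] c[of v v] v B by auto
      then show "\<exists>d\<in>c ` D'. adjacent G v d" using e d v unfolding adjacent_def by blast
    qed
    then have "domination_number G \<le> card (c ` D')" by (rule min)
    also have "\<dots> \<le> card D'"
      using D' finH by (intro card_image_le) (auto simp: dominating_set_def intro: finite_subset)
    finally show "domination_number G \<le> card D'" .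
  qed
qed

text \<open>Keeps a statement about all of \<open>Gamma0 G\<close> from being vacuous. Each vertex
  is doubled by a fresh point, which gives \<open>k = 4\<close>. An edge has to exist, as otherwise
  the rank would be 0.\<close>

lemma Gamma0_nonempty:
  fixes G :: "'a hypergraph"
  assumes inf: "infinite (UNIV :: 'a set)" and G: "simple_graph G" and E: "hyperedges G \<noteq> {}"
  shows "Gamma0 G \<noteq> {}"
proof -
  have finG: "finite (verts G)" using G unfolding simple_graph_def hypergraph_def by blast
  then have "infinite (UNIV - verts G)" using inf by simp
  then obtain T where T: "T \<subseteq> UNIV - verts G" "finite T" "card T = card (verts G)"
    using infinite_arbitrarily_large by metis
  then obtain h where h: "bij_betw h (verts G) T"
    using finG finite_same_card_bij by metis
  define B where "B v = {v, h v}" for v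
  have hv: "h v \<notin> verts G" if "v \<in> verts G" for v
    using h T that by (auto dest: bij_betwE)
  have card_B: "card (B v) = 2" if "v \<in> verts G" for v
    using hv[OF that] that unfolding B_def by (metis card_2_iff)
  have disj: "B u \<inter> B v = {}" if "u \<in> verts G" "v \<in> verts G" "u \<noteq> v" for u v
    using that hv h unfolding B_def bij_betw_def by (auto dest: inj_onD)
  have edge: "u \<noteq> v \<and> u \<in> verts G \<and> v \<in> verts G" if "{u, v} \<in> hyperedges G" for u v
    using simple_graph_edgeE[OF G that] by (metis doubleton_eq_iff)
  define H where
    "H = \<lparr>verts = (\<Union>v\<in>verts G. B v), hyperedges = {B u \<union> B v | u v. {u, v} \<in> hyperedges G}\<rparr>"
  have card4: "card (B u \<union> B v) = 4" if "{u, v} \<in> hyperedges G" for u v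
    using edge[OF that] card_B disj by (subst card_Un_disjoint) (auto simp: B_def)
  obtain u v where "{u, v} \<in> hyperedges G"
    using E simple_graph_edgeE[OF G] by (metis ex_in_conv)
  then have "card ` hyperedges H = {4}" "hyperedges H \<noteq> {}"
    using card4 unfolding H_def by force+
  then have "rank H = 4" unfolding rank_def by simp
  moreover have "disjoint_family_on B (verts G)"
    using disj unfolding disjoint_family_on_def by blast
  ultimately have "dilation_with 4 G (\<lambda>_. 2) B (\<lambda>_. {}) H"
    unfolding dilation_with_def using card_B
    by (auto simp: H_def disjoint_family_on_def B_def)
  then have "H \<in> Gamma0 G" unfolding Gamma0_def
    by (intro CollectI exI[of _ "4::nat"] conjI exI[of _ "\<lambda>_. 2"] exI[of _ B] exI[of _ "\<lambda>_. {}"]) auto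
  then show ?thesis by blast
qed

section \<open>Disjoint unions of cliques\<close>

text \<open>The edges of any matching \<open>N\<close> cover \<open>2 * card N\<close> of the
  \<open>2 * n\<close> vertices, so no matching exceeds a perfect one.\<close>

lemma matching_number_perfect:
  assumes G: "simple_graph G" and V: "card (verts G) = 2 * n"
    and M: "matching G M" "card M = n"
  shows "matching_number G = n"
proof -
  have fin: "finite (verts G)" and sub: "\<And>e. e \<in> hyperedges G \<Longrightarrow> e \<subseteq> verts G"
    and card2: "\<And>e. e \<in> hyperedges G \<Longrightarrow> card e = 2"
    using G unfolding simple_graph_def hypergraph_def by blast+
  have le: "card N \<le> n" if "matching G N" for N
  proof -
    have N: "N \<subseteq> hyperedges G" "disjoint N" using that unfolding matching_def by auto
    have "card (\<Union>N) = sum card N"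
      using N fin sub by (intro card_Union_disjoint)
        (blast intro: finite_subset)+
    also have "\<dots> = 2 * card N" using N card2 by (subst sum.cong[of N N card "\<lambda>_. 2"]) auto
    finally have "2 * card N \<le> card (verts G)" using N sub fin
      by (metis Union_least card_mono subsetD)
    then show ?thesis using V by simp
  qed
  show ?thesis unfolding matching_number_def
  proof (rule Max_eqI)
    show "finite {card M | M. matching G M}"
      by (rule finite_subset[of _ "{..n}"]) (use le in auto)
  qed (use le M in auto)
qed

text \<open>The labelling \<open>g\<close> encodes the components: they are its fibres on
  \<open>V\<close>, each made a clique, so counting components means counting labels.\<close>

definition clique_union :: "'a set \<Rightarrow> ('a \<Rightarrow> 'b) \<Rightarrow> 'a hypergraph" where
  "clique_union V g = \<lparr>verts = V,
     hyperedges = {{u, v} | u v. u \<in> V \<and> v \<in> V \<and> u \<noteq> v \<and> g u = g v}\<rparr>"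

lemma clique_union_simps [simp]:
  "verts (clique_union V g) = V"
  "e \<in> hyperedges (clique_union V g) \<longleftrightarrow>
     (\<exists>u v. e = {u, v} \<and> u \<in> V \<and> v \<in> V \<and> u \<noteq> v \<and> g u = g v)"
  by (simp_all add: clique_union_def)

lemma simple_graph_clique_union:
  assumes "finite V" "V \<noteq> {}"
  shows "simple_graph (clique_union V g)"
proof -
  have "e \<noteq> {} \<and> e \<subseteq> V \<and> card e = 2" if "e \<in> hyperedges (clique_union V g)" for e
    using that unfolding clique_union_simps by (elim exE conjE) simp
  then show ?thesis
    unfolding simple_graph_def hypergraph_def using assms
    by (simp add: clique_union_simps(1) del: clique_union_simps(2))
qed

lemma adjacent_clique_union:
  "adjacent (clique_union V g) u v \<longleftrightarrow> u \<in> V \<and> v \<in> V \<and> u \<noteq> v \<and> g u = g v"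
proof
  assume "adjacent (clique_union V g) u v"
  then obtain a b where "u \<noteq> v" "u \<in> {a, b}" "v \<in> {a, b}" "a \<in> V" "b \<in> V" "g a = g b"
    unfolding adjacent_def Bex_def clique_union_simps by metis
  then show "u \<in> V \<and> v \<in> V \<and> u \<noteq> v \<and> g u = g v" by auto
next
  assume "u \<in> V \<and> v \<in> V \<and> u \<noteq> v \<and> g u = g v"
  moreover from this have "{u, v} \<in> hyperedges (clique_union V g)"
    unfolding clique_union_simps by blast
  ultimately show "adjacent (clique_union V g) u v" unfolding adjacent_def by (meson insertI1 insertI2)
qed

text \<open>A vertex dominates exactly its own clique, so \<open>D\<close> has to meet every fibre;
  equality of the two images under \<open>g\<close> expresses this.\<close>

lemma dominating_set_clique_union:
  "dominating_set (clique_union V g) D \<longleftrightarrow> D \<subseteq> V \<and> g ` D = g ` V"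
proof
  assume "dominating_set (clique_union V g) D"
  then have "D \<subseteq> V" "\<forall>x\<in>V - D. \<exists>y\<in>D. g x = g y"
    unfolding dominating_set_def adjacent_clique_union by auto
  then show "D \<subseteq> V \<and> g ` D = g ` V" by blast
next
  assume D: "D \<subseteq> V \<and> g ` D = g ` V"
  have "\<exists>y\<in>D. y \<in> V \<and> x \<noteq> y \<and> g x = g y" if "x \<in> V - D" for x
  proof -
    have "g x \<in> g ` D" using that D by blast
    then show ?thesis using that D by blast
  qed
  with D show "dominating_set (clique_union V g) D"
    unfolding dominating_set_def adjacent_clique_union by auto
qed

lemma domination_number_clique_union:
  assumes "finite V"
  shows "domination_number (clique_union V g) = card (g ` V)"
proof -
  \<comment> \<open>A transversal: one vertex from each clique.\<close>
  obtain D where D: "D \<subseteq> V" "inj_on g D" "g ` D = g ` V"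
    by (metis order_refl subset_image_inj)
  show ?thesis
  proof (rule domination_number_eqI)
    show "dominating_set (clique_union V g) D" using D dominating_set_clique_union by metis
    show "card D = card (g ` V)" using D by (metis card_image)
    show "card (g ` V) \<le> card D'" if "dominating_set (clique_union V g) D'" for D'
      using that assms unfolding dominating_set_clique_union
      by (metis card_image_le finite_subset)
  qed (use assms in simp)
qed

section \<open>The graphs with prescribed matching and domination numbers\<close>

theorem theorem6:
  fixes n :: nat
  assumes "infinite (UNIV :: 'a set)"
    and "n \<ge> 2"
  shows "\<forall>m\<in>{1..n - 1}. \<exists>G :: 'a hypergraph. simple_graph G \<and> Gamma0 G \<noteq> {} \<and>
           (\<forall>H\<in>Gamma0 G. matching_number H = n \<and> domination_number H = m)"
proof
  fix m assume m: "m \<in> {1..n - 1}"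
  obtain f :: "nat \<Rightarrow> 'a" where f: "inj f"
    using assms(1) infinite_countable_subset by blast
  define V where "V = f ` {..<2 * n}"
  \<comment> \<open>Halving gives \<open>2 * i\<close> and \<open>2 * i + 1\<close> the same label.
    The cap merges the pairs numbered \<open>m - 1\<close> to \<open>n - 1\<close> into one clique
    on \<open>2 * (n - m + 1)\<close> vertices; each earlier pair remains a separate edge.\<close>
  define c where "c i = min (i div 2) (m - 1)" for i :: nat
  define g where "g x = c (inv f x)" for x
  define G where "G = clique_union V g"
  define M where "M = (\<lambda>i. {f (2 * i), f (2 * i + 1)}) ` {..<n}"
  have gf: "g (f i) = c i" for i using f by (simp add: g_def)
  have V: "finite V" "V \<noteq> {}" "card V = 2 * n"
    using assms(2) f unfolding V_def by (auto simp: card_image inj_on_subset lessThan_empty_iff)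
  have G: "simple_graph G" unfolding G_def using V by (intro simple_graph_clique_union)
  have edge: "{f (2 * i), f (2 * i + 1)} \<in> hyperedges G" if "i < n" for i
  proof -
    have "f (2 * i) \<in> V" "f (2 * i + 1) \<in> V" "f (2 * i) \<noteq> f (2 * i + 1)"
      "g (f (2 * i)) = g (f (2 * i + 1))"
      using that f by (auto simp: V_def gf c_def inj_eq)
    then show ?thesis unfolding G_def clique_union_simps by blast
  qed
  \<comment> \<open>The consecutive pairs cover all of \<open>V\<close>.\<close>
  have no_isolated: "\<exists>e\<in>hyperedges G. v \<in> e" if v: "v \<in> verts G" for v
  proof -
    obtain j where j: "j < 2 * n" "v = f j" using v by (auto simp: G_def V_def)
    obtain i where "j = 2 * i \<or> j = 2 * i + 1" by (metis evenE oddE)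
    then have "i < n" "v \<in> {f (2 * i), f (2 * i + 1)}" using j by auto
    then show ?thesis using edge by blast
  qed
  have "disjoint_family_on (\<lambda>i. {f (2 * i), f (2 * i + 1)}) {..<n}"
    unfolding disjoint_family_on_def using f by (auto simp: inj_eq)
  \<comment> \<open>A disjoint family of non-empty sets is injective, which gives the
    cardinality.\<close>
  then have M: "disjoint M" "card M = n"
    unfolding M_def by (simp_all add: disjoint_family_on_iff_disjoint_image card_image)
  have "matching G M" using M edge unfolding matching_def M_def by blast
  then have match: "matching_number G = n"
    using matching_number_perfect[OF G _ _ M(2)] V(3) by (simp add: G_def)
  have "c ` {..<2 * n} = {..<m}"
  proof (intro equalityI subsetI)
    fix k assume "k \<in> {..<m}"
    \<comment> \<open>The label \<open>k\<close> is attained at the first element of pair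
      \<open>k\<close>, which is below \<open>2 * n\<close> because \<open>m < n\<close>.\<close>
    then have "k = c (2 * k)" "2 * k < 2 * n" using m by (auto simp: c_def)
    then show "k \<in> c ` {..<2 * n}" by blast
  qed (use m in \<open>auto simp: c_def\<close>)
  then have "g ` V = {..<m}" unfolding V_def image_image gf .
  then have dom: "domination_number G = m"
    using V by (simp add: G_def domination_number_clique_union)
  have "hyperedges G \<noteq> {}" using edge[of 0] assms(2) by auto
  then have "Gamma0 G \<noteq> {}" using Gamma0_nonempty assms(1) G by blast
  moreover have "matching_number H = n \<and> domination_number H = m" if "H \<in> Gamma0 G" for H
    using match dom matching_number_Gamma0[OF G that] domination_number_Gamma0[OF G that no_isolated]
    by simp
  ultimately show "\<exists>G :: 'a hypergraph. simple_graph G \<and> Gamma0 G \<noteq> {} \<and>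
      (\<forall>H\<in>Gamma0 G. matching_number H = n \<and> domination_number H = m)"
    using G by blast
qed

end
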